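(* Suppose that $S=\{t^*\}$ is a singleton, that $\sup_{t\in T}\mathrm{E}\left[l^2(\xi-t)\right]<+\infty$, and that there exists a random variable $K(\xi)$ with $\mathrm{E}[K(\xi)^2]<\infty$ such that $|l(\xi-t_1)-l(\xi-t_2)|\le K(\xi)|t_1-t_2|$ for all $t_1,t_2\in T$ and a.e. $\xi$. Then, as $n\to\infty$, $\sigma_n^2\to\sigma^2(t^* )$ with probability 1.
   Context: Let $u$ be a proper closed concave nondecreasing utility function with $u(0)=0$ and $1\in\partial u(0)$ (subdifferential), and let $l(z)=-u(-z)$ (so $l$ is proper, closed, convex and nondecreasing). Let $\xi$ be a real random variable (the random loss), $T\subset\mathbb{R}$ a compact interval, and $S$ the set of optimal solutions of $$\min_{t\in T}\ t+\mathrm{E}[l(\xi-t)].$$ Let $\xi_1,\xi_2,\ldots$ be i.i.d. copies of $\xi$, and let $t_n$ be an optimal solution of the sample average approximation $$\min_{t\in T}\ t+\frac1n\sum_{i=1}^n l(\xi_i-t).$$ Let $\sigma^2(t)=\mathrm{Var}[l(\xi-t)]$ and $$\sigma_n^2=\frac1n\sum_{i=1}^n l^2(\xi_i-t_n)-\left(\frac1n\sum_{i=1}^n l(\xi_i-t_n)\right)^2.$$ *)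

theory Defs
  imports "HOL-Probability.Probability"
begin

text \<open>Utility functions take values in \<open>[-\<infinity>, \<infinity>)\<close>, loss functions in \<open>(-\<infinity>, \<infinity>]\<close>.\<close>

definition hypograph :: "(real \<Rightarrow> ereal) \<Rightarrow> (real \<times> real) set" where
  "hypograph u = {(x, r). ereal r \<le> u x}"

definition proper_concave :: "(real \<Rightarrow> ereal) \<Rightarrow> bool" where
  "proper_concave u \<longleftrightarrow>
     convex (hypograph u) \<and> (\<forall>x. u x < \<infinity>) \<and> (\<exists>x. u x > -\<infinity>)"

definition closed_concave :: "(real \<Rightarrow> ereal) \<Rightarrow> bool" where
  "closed_concave u \<longleftrightarrow> convex (hypograph u) \<and> closed (hypograph u)"

text \<open>For a concave function the subgradient inequality is the reversed one.\<close>

definition concave_subdifferential :: "(real \<Rightarrow> ereal) \<Rightarrow> real \<Rightarrow> real set" where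
  "concave_subdifferential u x = {g. \<forall>y. u y \<le> u x + ereal (g * (y - x))}"

definition utility_function :: "(real \<Rightarrow> ereal) \<Rightarrow> bool" where
  "utility_function u \<longleftrightarrow>
     proper_concave u \<and> closed_concave u \<and> mono u \<and>
     u 0 = 0 \<and> 1 \<in> concave_subdifferential u 0"

definition loss_of :: "(real \<Rightarrow> ereal) \<Rightarrow> real \<Rightarrow> ereal" where
  "loss_of u z = - u (- z)"

text \<open>
  \<open>e2ennreal\<close> truncates negative values to 0, so the two integrals are those of the positive
  and the negative part. As \<open>\<infinity> - \<infinity> = \<infinity>\<close> in \<^typ>\<open>ereal\<close>, the expectation is \<open>\<infinity>\<close> if both are infinite.
\<close>

definition ext_expectation :: "'a measure \<Rightarrow> ('a \<Rightarrow> ereal) \<Rightarrow> ereal" where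
  "ext_expectation M X =
     enn2ereal (\<integral>\<^sup>+\<omega>. e2ennreal (X \<omega>) \<partial>M) - enn2ereal (\<integral>\<^sup>+\<omega>. e2ennreal (- X \<omega>) \<partial>M)"

definition ext_variance :: "'a measure \<Rightarrow> ('a \<Rightarrow> ereal) \<Rightarrow> ereal" where
  "ext_variance M X = ext_expectation M (\<lambda>\<omega>. (X \<omega> - ext_expectation M X)\<^sup>2)"

lemma ext_expectation_cong_AE:
  assumes "AE \<omega> in M. X \<omega> = Y \<omega>"
  shows "ext_expectation M X = ext_expectation M Y"
proof -
  have "(\<integral>\<^sup>+\<omega>. e2ennreal (X \<omega>) \<partial>M) = (\<integral>\<^sup>+\<omega>. e2ennreal (Y \<omega>) \<partial>M)"
    using assms by (intro nn_integral_cong_AE) auto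
  moreover have "(\<integral>\<^sup>+\<omega>. e2ennreal (- X \<omega>) \<partial>M) = (\<integral>\<^sup>+\<omega>. e2ennreal (- Y \<omega>) \<partial>M)"
    using assms by (intro nn_integral_cong_AE) auto
  ultimately show ?thesis
    by (simp add: ext_expectation_def)
qed

lemma ext_expectation_eq_expectation:
  assumes "integrable M f" and "AE \<omega> in M. X \<omega> = ereal (f \<omega>)"
  shows "ext_expectation M X = ereal (integral\<^sup>L M f)"
proof -
  have fin: "(\<integral>\<^sup>+\<omega>. ennreal (f \<omega>) \<partial>M) < \<infinity>" "(\<integral>\<^sup>+\<omega>. ennreal (- f \<omega>) \<partial>M) < \<infinity>"
    using assms(1) by (auto simp: real_integrable_def less_top)
  have enn: "enn2ereal a = ereal (enn2real a)" if "a < \<infinity>" for a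
    using that by (cases a) (auto simp: enn2ereal_ennreal)
  have "ext_expectation M X = ext_expectation M (\<lambda>\<omega>. ereal (f \<omega>))"
    by (rule ext_expectation_cong_AE[OF assms(2)])
  also have "\<dots> = ereal (integral\<^sup>L M f)"
    unfolding ext_expectation_def real_lebesgue_integral_def[OF assms(1)]
    by (simp add: enn[OF fin(1)] enn[OF fin(2)])
  finally show ?thesis .
qed

lemma (in prob_space) ext_variance_eq_variance:
  assumes "f \<in> borel_measurable M" and "integrable M (\<lambda>\<omega>. (f \<omega>)\<^sup>2)"
    and "AE \<omega> in M. X \<omega> = ereal (f \<omega>)"
  shows "ext_variance M X = ereal (variance f)"
proof -
  have int: "integrable M f"
    using assms(1,2) by (rule square_integrable_imp_integrable)
  have E: "ext_expectation M X = ereal (expectation f)"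
    using int assms(3) by (rule ext_expectation_eq_expectation)
  have "integrable M (\<lambda>\<omega>. (f \<omega> - expectation f)\<^sup>2)"
    using int assms(2) by (simp add: power2_diff)
  moreover have "AE \<omega> in M. (X \<omega> - ext_expectation M X)\<^sup>2 = ereal ((f \<omega> - expectation f)\<^sup>2)"
    using assms(3) by eventually_elim (simp add: E power2_eq_square)
  ultimately show ?thesis
    unfolding ext_variance_def by (rule ext_expectation_eq_expectation)
qed

definition optimal_solutions :: "('a \<Rightarrow> 'b::ord) \<Rightarrow> 'a set \<Rightarrow> 'a set" where
  "optimal_solutions f T = {t. is_arg_min f (\<lambda>s. s \<in> T) t}"

definition true_objective ::
    "'a measure \<Rightarrow> (real \<Rightarrow> ereal) \<Rightarrow> ('a \<Rightarrow> real) \<Rightarrow> real \<Rightarrow> ereal" where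
  "true_objective M l \<xi> t = ereal t + ext_expectation M (\<lambda>\<omega>. l (\<xi> \<omega> - t))"

text \<open>Samples are numbered from 1.\<close>

definition sample_mean :: "nat \<Rightarrow> (nat \<Rightarrow> ereal) \<Rightarrow> ereal" where
  "sample_mean n f = ereal (1 / real n) * (\<Sum>i=1..n. f i)"

definition saa_objective ::
    "(real \<Rightarrow> ereal) \<Rightarrow> nat \<Rightarrow> (nat \<Rightarrow> real) \<Rightarrow> real \<Rightarrow> ereal" where
  "saa_objective l n x t = ereal t + sample_mean n (\<lambda>i. l (x i - t))"

definition saa_variance ::
    "(real \<Rightarrow> ereal) \<Rightarrow> nat \<Rightarrow> (nat \<Rightarrow> real) \<Rightarrow> real \<Rightarrow> ereal" where
  "saa_variance l n x t =
     sample_mean n (\<lambda>i. (l (x i - t))\<^sup>2) - (sample_mean n (\<lambda>i. l (x i - t)))\<^sup>2"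

end

theory Submission
  imports Defs
begin

text \<open>
  The sample variance is the mean of the squared losses at \<open>t\<^sub>n\<close> minus the square of the mean loss at
  \<open>t\<^sub>n\<close>. At the fixed point \<open>t\<^sup>*\<close> both means converge by the strong law of large numbers. Replacing \<open>t\<^sup>*\<close>
  by \<open>t\<^sub>n\<close> costs \<open>\<bar>t\<^sub>n - t\<^sup>*\<bar>\<close> times a mean of Lipschitz factors: \<open>\<bar>K\<bar>\<close> for the losses, a combination of
  \<open>K\<^sup>2\<close> and the squared loss for their squares (\<open>abs_power2_diff_le\<close>). These factors are integrable, so
  their means stay bounded, again by the strong law, and all that matters is that \<open>t\<^sub>n\<close> tends to \<open>t\<^sup>*\<close>
  (\<open>means_at_convergent_points_tendsto\<close>).

  Consistency of the minimizers comes from convexity (\<open>convex_minimizers_tendsto\<close>). If \<open>d\<close> is a point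
  near \<open>t\<^sup>*\<close>, the true objective is larger at \<open>d\<close> than at \<open>t\<^sup>*\<close>, hence so are the sample objectives
  eventually; by convexity their minimizers then lie on the \<open>t\<^sup>*\<close> side of \<open>d\<close>. Only countably many points
  \<open>d\<close> are needed, and at each of them the strong law applies.

  The strong law for integrable variables is derived from a maximal inequality in the style of
  Garsia (\<open>AE_bdd_above_running_max\<close>): for an i.i.d. sequence with negative mean, the partial sums are
  almost surely bounded from above. Applied to \<open>f - d\<close> for \<open>d\<close> above the mean and to the corresponding
  shift of \<open>- f\<close>, it bounds the means from both sides.

  The loss is extended-valued and the hypotheses hold only almost surely for each fixed \<open>t\<close>, whereas
  \<open>t\<^sub>n\<close> is random. Monotonicity of the loss makes both harmless: finiteness at the left end point of
  \<open>T\<close> implies finiteness on \<open>T\<close>, and a Lipschitz bound relative to \<open>t\<^sup>*\<close> on a countable dense set extends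
  to all of \<open>T\<close> (\<open>antimono_lipschitz_at_extend\<close>).
\<close>

section \<open>The strong law of large numbers\<close>

text \<open>
  This is the maximum over \<open>k \<le> n\<close> of the partial sums \<open>\<Sum>i<k. f (x i)\<close>, the empty sum
  included. It is defined by peeling off the first term rather than the last, since the recursion
  then speaks of the same maximum for the shifted sequence.
\<close>

primrec running_max :: "('a \<Rightarrow> real) \<Rightarrow> nat \<Rightarrow> (nat \<Rightarrow> 'a) \<Rightarrow> real" where
  "running_max f 0 x = 0"
| "running_max f (Suc n) x = max 0 (f (x 0) + running_max f n (\<lambda>i. x (Suc i)))"

lemma running_max_nonneg: "0 \<le> running_max f n x"
  by (cases n) auto

lemma running_max_le_Suc: "running_max f n x \<le> running_max f (Suc n) x"
proof (induction n arbitrary: x)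
  case (Suc n)
  show ?case
    using Suc[of "\<lambda>i. x (Suc i)"] by auto
qed auto

lemma incseq_running_max: "incseq (\<lambda>n. running_max f n x)"
  by (intro incseq_SucI running_max_le_Suc)

lemma sum_le_running_max: "(\<Sum>i<n. f (x i)) \<le> running_max f n x"
proof (induction n arbitrary: x)
  case (Suc n)
  show ?case
    using Suc[of "\<lambda>i. x (Suc i)"] by (simp add: sum.lessThan_Suc_shift del: sum.lessThan_Suc)
qed auto

lemma running_max_le_sum_abs: "running_max f n x \<le> (\<Sum>i<n. \<bar>f (x i)\<bar>)"
proof (induction n arbitrary: x)
  case (Suc n)
  have "0 \<le> (\<Sum>i<n. \<bar>f (x (Suc i))\<bar>)" by (intro sum_nonneg) auto
  then show ?case
    using Suc[of "\<lambda>i. x (Suc i)"] by (simp add: sum.lessThan_Suc_shift del: sum.lessThan_Suc)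
qed auto

text \<open>
  Prepending a term moves all partial sums by the same finite amount. Hence boundedness of the partial
  sums from above is a shift-invariant event.
\<close>

lemma bdd_above_running_max_Suc:
  "bdd_above (range (\<lambda>n. running_max f n x)) \<longleftrightarrow>
   bdd_above (range (\<lambda>n. running_max f n (\<lambda>i. x (Suc i))))"
proof
  assume "bdd_above (range (\<lambda>n. running_max f n x))"
  then obtain B where B: "\<And>n. running_max f n x \<le> B"
    by (auto simp: bdd_above_def)
  have "running_max f n (\<lambda>i. x (Suc i)) \<le> B - f (x 0)" for n
    using B[of "Suc n"] by auto
  then show "bdd_above (range (\<lambda>n. running_max f n (\<lambda>i. x (Suc i))))"
    by (auto simp: bdd_above_def)
next
  assume "bdd_above (range (\<lambda>n. running_max f n (\<lambda>i. x (Suc i))))"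
  then obtain B where B: "\<And>n. running_max f n (\<lambda>i. x (Suc i)) \<le> B"
    by (auto simp: bdd_above_def)
  have "running_max f n x \<le> max 0 (f (x 0) + B)" for n
  proof (cases n)
    case (Suc m)
    then show ?thesis using B[of m] by auto
  qed auto
  then show "bdd_above (range (\<lambda>n. running_max f n x))"
    by (auto simp: bdd_above_def)
qed

context sequence_space
begin

lemma measurable_shift [measurable]: "(\<lambda>x i. x (Suc i)) \<in> measurable S S"
  by (rule measurable_PiM_single') (auto simp: space_PiM)

lemma measurable_running_max [measurable]:
  assumes [measurable]: "f \<in> borel_measurable M"
  shows "running_max f n \<in> borel_measurable S"
proof (induction n)
  case (Suc n)
  note Suc [measurable]
  have "running_max f n \<circ> (\<lambda>x i. x (Suc i)) \<in> borel_measurable S"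
    by measurable
  then have [measurable]: "(\<lambda>x. running_max f n (\<lambda>i. x (Suc i))) \<in> borel_measurable S"
    by (simp add: comp_def)
  show ?case by simp
qed simp

lemma integrable_component:
  fixes f :: "_ \<Rightarrow> real"
  assumes f: "integrable M f"
  shows "integrable S (\<lambda>x. f (x i))"
proof -
  have "distr S M (\<lambda>x. x i) = M" by (rule PiM_component) simp
  with f show ?thesis
    using integrable_distr[of "\<lambda>x. x i" S M f] by simp
qed

lemma integrable_running_max:
  assumes "integrable M f"
  shows "integrable S (running_max f n)"
proof (rule Bochner_Integration.integrable_bound)
  show "integrable S (\<lambda>x. \<Sum>i<n. \<bar>f (x i)\<bar>)"
    by (intro Bochner_Integration.integrable_sum integrable_abs integrable_component assms)
  show "running_max f n \<in> borel_measurable S"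
    using assms by measurable
  show "AE x in S. norm (running_max f n x) \<le> norm (\<Sum>i<n. \<bar>f (x i)\<bar>)"
    by (simp add: running_max_nonneg running_max_le_sum_abs)
qed

lemma distr_pair_snd_sequence: "distr (M \<Otimes>\<^sub>M S) S snd = S"
proof (rule measure_eqI)
  fix A assume A: "A \<in> sets (distr (M \<Otimes>\<^sub>M S) S snd)"
  then have "A \<subseteq> space S"
    using sets.sets_into_space[of A S] by simp
  then have "snd -` A \<inter> space (M \<Otimes>\<^sub>M S) = space M \<times> A"
    by (auto simp: space_pair_measure)
  with A show "emeasure (distr (M \<Otimes>\<^sub>M S) S snd) A = emeasure S A"
    by (simp add: emeasure_distr P.emeasure_pair_measure_Times M.emeasure_space_1)
qed simp

text \<open>
  Let \<open>A\<close> be the event that the running maxima \<open>R\<^sub>n\<close> are unbounded, and write an i.i.d. sequence as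
  a first term \<open>s\<close> followed by an independent sequence \<open>\<omega>\<close> with the same law. Since \<open>A\<close> is
  shift-invariant, the expectation of \<open>R\<^sub>n\<^sub>+\<^sub>1 - R\<^sub>n\<close> on \<open>A\<close>, which is nonnegative, equals that of
  \<open>max 0 (f s + R\<^sub>n \<omega>) - R\<^sub>n \<omega> = max (- R\<^sub>n \<omega>) (f s)\<close> on \<open>\<omega> \<in> A\<close>. This integrand is bounded by
  \<open>\<bar>f s\<bar>\<close> and tends to \<open>f s\<close> on \<open>A\<close>, so in the limit the mean of \<open>f\<close> times the probability of \<open>A\<close>
  is nonnegative. A negative mean forces \<open>A\<close> to be a null set.
\<close>

lemma AE_bdd_above_running_max:
  assumes f: "integrable M f" and neg: "integral\<^sup>L M f < 0"
  shows "AE x in S. bdd_above (range (\<lambda>n. running_max f n x))"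
proof -
  define A where "A = {x \<in> space S. \<not> bdd_above (range (\<lambda>n. running_max f n x))}"
  have [measurable]: "f \<in> borel_measurable M" using f by simp
  \<comment> \<open>Natural numbers as bounds turn the event into a countable combination of measurable ones.\<close>
  have A_eq: "A = {x \<in> space S. \<forall>b::nat. \<exists>n. running_max f n x > real b}"
  proof -
    have "\<not> bdd_above (range (\<lambda>n. running_max f n x)) \<longleftrightarrow> (\<forall>b::nat. \<exists>n. running_max f n x > real b)" for x
    proof -
      have "bdd_above (range (\<lambda>n. running_max f n x)) \<longleftrightarrow> (\<exists>b::nat. \<forall>n. running_max f n x \<le> real b)"
        by (auto simp: bdd_above_def) (meson real_arch_simple order_trans)
      then show ?thesis by (auto simp: not_le)
    qed
    then show ?thesis by (simp add: A_def)
  qed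
  have [measurable]: "A \<in> sets S"
    unfolding A_eq by measurable
  interpret Q: pair_sigma_finite M S ..
  have PS: "prob_space S" by (rule prob_space_axioms)
  have shift: "distr (M \<Otimes>\<^sub>M S) S (\<lambda>p. case_nat (fst p) (snd p)) = S"
    using PiM_iter by (simp add: split_beta')
  have ms: "(\<lambda>p. case_nat (fst p) (snd p)) \<in> measurable (M \<Otimes>\<^sub>M S) S"
    by measurable
  have A_shift: "case_nat s \<omega> \<in> A \<longleftrightarrow> \<omega> \<in> A" if "s \<in> space M" "\<omega> \<in> space S" for s \<omega>
  proof -
    have "case_nat s \<omega> \<in> space S"
      using that by (auto simp: space_PiM PiE_iff split: nat.split)
    then show ?thesis
      using that bdd_above_running_max_Suc[of f "case_nat s \<omega>"] by (simp add: A_def)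
  qed
  have int: "integrable S (\<lambda>x. running_max f n x * indicator A x)" for n
    by (intro integrable_real_mult_indicator integrable_running_max f) auto
  let ?Q = "M \<Otimes>\<^sub>M S"
  let ?g = "\<lambda>n p. max (- running_max f n (snd p)) (f (fst p)) * indicator A (snd p)"
  have bound: "\<bar>?g n p\<bar> \<le> \<bar>f (fst p)\<bar>" for n p
    using running_max_nonneg[of f n "snd p"] by (auto simp: indicator_def)
  have intf: "integrable ?Q (\<lambda>p. f (fst p))"
    using f integrable_distr[of fst ?Q M f] by (simp add: prob_space.distr_pair_fst[OF PS])
  have pos: "0 \<le> (\<integral>p. ?g n p \<partial>?Q)" for n
  proof -
    let ?G = "\<lambda>n x. running_max f n x * indicator A x"
    have 1: "integrable ?Q (\<lambda>p. ?G (Suc n) (case_nat (fst p) (snd p)))"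
      and 2: "(\<integral>x. ?G (Suc n) x \<partial>S) = (\<integral>p. ?G (Suc n) (case_nat (fst p) (snd p)) \<partial>?Q)"
      using int[of "Suc n"] integrable_distr_eq[OF ms, of "?G (Suc n)"] integral_distr[OF ms, of "?G (Suc n)"]
      unfolding shift by (simp_all del: running_max.simps)
    have 3: "integrable ?Q (\<lambda>p. ?G n (snd p))"
      and 4: "(\<integral>x. ?G n x \<partial>S) = (\<integral>p. ?G n (snd p) \<partial>?Q)"
      using int[of n] integrable_distr_eq[of snd ?Q S "?G n"] integral_distr[of snd ?Q S "?G n"]
      unfolding distr_pair_snd_sequence by simp_all
    have "0 \<le> (\<integral>x. ?G (Suc n) x \<partial>S) - (\<integral>x. ?G n x \<partial>S)"
      using integral_mono[OF int[of n] int[of "Suc n"]] running_max_le_Suc[of f n]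
      by (auto simp: indicator_def)
    also have "\<dots> = (\<integral>p. ?G (Suc n) (case_nat (fst p) (snd p)) - ?G n (snd p) \<partial>?Q)"
      using 1 3 by (simp only: 2 4 Bochner_Integration.integral_diff)
    also have "\<dots> = (\<integral>p. ?g n p \<partial>?Q)"
      by (rule Bochner_Integration.integral_cong)
         (auto simp: space_pair_measure A_shift indicator_def max_def)
    finally show ?thesis .
  qed
  have lim: "(\<lambda>n. \<integral>p. ?g n p \<partial>?Q) \<longlonglongrightarrow> (\<integral>p. f (fst p) * indicator A (snd p) \<partial>?Q)"
  proof (rule integral_dominated_convergence[where w = "\<lambda>p. \<bar>f (fst p)\<bar>"])
    have "(\<lambda>n. ?g n p) \<longlonglongrightarrow> f (fst p) * indicator A (snd p)" for p
    proof (cases "snd p \<in> A")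
      case True
      obtain b :: nat where b: "- f (fst p) < b" using reals_Archimedean2 by blast
      from True obtain N where "real b < running_max f N (snd p)"
        unfolding A_eq by blast
      with b have N: "- f (fst p) < running_max f N (snd p)" by simp
      have "?g n p = f (fst p) * indicator A (snd p)" if "n \<ge> N" for n
        using incseqD[OF incseq_running_max that, of f "snd p"] N by (simp add: max_def)
      then have "\<forall>\<^sub>F n in sequentially. ?g n p = f (fst p) * indicator A (snd p)"
        by (rule eventually_sequentiallyI)
      then show ?thesis by (rule tendsto_eventually)
    qed simp
    then show "AE p in ?Q. (\<lambda>n. ?g n p) \<longlonglongrightarrow> f (fst p) * indicator A (snd p)"
      by simp
    show "integrable ?Q (\<lambda>p. \<bar>f (fst p)\<bar>)" using intf by simp
    show "AE p in ?Q. norm (?g n p) \<le> \<bar>f (fst p)\<bar>" for n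
      using bound[of n] by simp
  qed measurable
  have "0 \<le> (\<integral>p. f (fst p) * indicator A (snd p) \<partial>?Q)"
    using LIMSEQ_le_const[OF lim] pos by blast
  also have "\<dots> = (\<integral>s. (\<integral>\<omega>. f s * indicator A \<omega> \<partial>S) \<partial>M)"
  proof (subst Q.integral_fst'[symmetric])
    show "integrable ?Q (\<lambda>p. f (fst p) * indicator A (snd p))"
      by (rule Bochner_Integration.integrable_bound[OF intf]) (auto simp: indicator_def)
  qed simp
  also have "\<dots> = integral\<^sup>L M f * measure S A"
    by simp
  finally have "measure S A = 0"
    using neg by (simp add: zero_le_mult_iff measure_le_0_iff)
  then have "emeasure S A = 0"
    by (simp add: P.emeasure_eq_measure)
  then have "AE x in S. x \<notin> A"
    by (intro AE_not_in) (auto intro!: null_setsI)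
  then show ?thesis
    by (rule AE_mp) (auto simp: A_def intro!: AE_I2)
qed

text \<open>
  Subtracting from \<open>f\<close> a constant \<open>d\<close> strictly between its mean and \<open>c\<close> makes the mean negative, so
  the partial sums of \<open>f - d\<close> stay bounded from above and disappear after division by \<open>n\<close>.
\<close>

lemma AE_eventually_mean_less:
  assumes f: "integrable M f" and c: "integral\<^sup>L M f < c"
  shows "AE x in S. \<forall>\<^sub>F n in sequentially. (\<Sum>i<n. f (x i)) / n < c"
proof -
  obtain d where d: "integral\<^sup>L M f < d" "d < c"
    using dense[OF c] by auto
  have "AE x in S. bdd_above (range (\<lambda>n. running_max (\<lambda>s. f s - d) n x))"
    using f d by (intro AE_bdd_above_running_max) (auto simp: M.prob_space)
  then show ?thesis
  proof eventually_elim
    case (elim x)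
    then obtain B where B: "\<And>n. running_max (\<lambda>s. f s - d) n x \<le> B"
      by (auto simp: bdd_above_def)
    have le: "(\<Sum>i<n. f (x i)) \<le> B + n * d" for n
      using sum_le_running_max[of "\<lambda>s. f s - d" x n] B[of n] by (simp add: sum_subtractf)
    have "((\<lambda>n. B / real n) \<longlonglongrightarrow> 0)"
      by (rule lim_const_over_n)
    then have "\<forall>\<^sub>F n in sequentially. B / real n < c - d"
      using d by (intro order_tendstoD(2)) auto
    then show ?case
      using eventually_gt_at_top[of 0]
    proof eventually_elim
      case (elim n)
      have "(\<Sum>i<n. f (x i)) / n \<le> (B + n * d) / n"
        using le[of n] by (intro divide_right_mono) auto
      also have "\<dots> = B / n + d" using elim by (simp add: field_simps)
      finally show ?case using elim by simp
    qed
  qed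
qed

theorem strong_law_of_large_numbers_PiM:
  assumes f: "integrable M f"
  shows "AE x in S. (\<lambda>n. (\<Sum>i<n. f (x i)) / n) \<longlonglongrightarrow> integral\<^sup>L M f"
proof -
  let ?m = "integral\<^sup>L M f"
  let ?e = "\<lambda>k::nat. 1 / real (Suc k)"
  have "AE x in S. \<forall>k. \<forall>\<^sub>F n in sequentially. (\<Sum>i<n. f (x i)) / n < ?m + ?e k"
    unfolding AE_all_countable using f by (intro allI AE_eventually_mean_less) auto
  moreover have "AE x in S. \<forall>k. \<forall>\<^sub>F n in sequentially. (\<Sum>i<n. - f (x i)) / n < - ?m + ?e k"
    unfolding AE_all_countable using f by (intro allI AE_eventually_mean_less) auto
  ultimately show ?thesis
  proof eventually_elim
    case (elim x)
    show ?case
    proof (rule LIMSEQ_I)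
      fix r :: real assume "r > 0"
      then obtain k where k: "?e k < r"
        using nat_approx_posE by blast
      have "\<forall>\<^sub>F n in sequentially. norm ((\<Sum>i<n. f (x i)) / n - ?m) < r"
        using elim(1)[rule_format, of k] elim(2)[rule_format, of k]
      proof eventually_elim
        case (elim n)
        then show ?case using k by (auto simp: sum_negf abs_less_iff)
      qed
      then show "\<exists>no. \<forall>n\<ge>no. norm ((\<Sum>i<n. f (x i)) / n - ?m) < r"
        by (simp add: eventually_sequentially)
    qed
  qed
qed

end

text \<open>
  Identically distributed independent variables have the infinite product measure as their joint law,
  so the almost sure statement can be pulled back from sequence space.
\<close>

theorem (in prob_space) strong_law_of_large_numbers:
  fixes X :: "nat \<Rightarrow> 'a \<Rightarrow> 'b" and f :: "'b \<Rightarrow> real"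
  assumes indep: "indep_vars (\<lambda>_. N) X {1..}"
    and law: "\<And>i. i \<ge> 1 \<Longrightarrow> distr M N (X i) = L"
    and f: "integrable L f"
  shows "AE \<omega> in M. (\<lambda>n. (\<Sum>i=1..n. f (X i \<omega>)) / n) \<longlonglongrightarrow> integral\<^sup>L L f"
proof -
  have rv: "random_variable N (X i)" if "i \<ge> 1" for i
    using indep that by (auto simp: indep_vars_def2)
  have "prob_space L"
    using prob_space_distr[OF rv[of 1]] law[of 1] by simp
  then interpret L: sequence_space L
    by (simp add: sequence_space_def product_prob_space_def product_prob_space_axioms_def
        product_sigma_finite_def prob_space_imp_sigma_finite)
  \<comment> \<open>Renumbering from 0: the blocks \<open>{Suc i}\<close> are disjoint, and each is read off at its only index.\<close>
  have "indep_vars (\<lambda>i. \<Pi>\<^sub>M j\<in>{Suc i}. N) (\<lambda>i \<omega>. restrict (\<lambda>j. X j \<omega>) {Suc i}) UNIV"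
    by (rule indep_vars_restrict[OF indep]) (auto simp: disjoint_family_on_def)
  from indep_vars_compose2[OF this, where Y = "\<lambda>i x. x (Suc i)" and N = "\<lambda>_. N"]
  have "indep_vars (\<lambda>_. N) (\<lambda>i. X (Suc i)) UNIV"
    by simp
  then have joint_law: "distr M (\<Pi>\<^sub>M i\<in>UNIV. N) (\<lambda>\<omega> i. X (Suc i) \<omega>) = (\<Pi>\<^sub>M i\<in>UNIV. L)"
    using indep_vars_iff_distr_eq_PiM'[of UNIV "\<lambda>i. X (Suc i)" "\<lambda>_. N"] rv law
    by (simp add: restrict_def)
  have "AE x in distr M (\<Pi>\<^sub>M i\<in>UNIV. N) (\<lambda>\<omega> i. X (Suc i) \<omega>).
      (\<lambda>n. (\<Sum>i<n. f (x i)) / n) \<longlonglongrightarrow> integral\<^sup>L L f"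
    unfolding joint_law by (rule L.strong_law_of_large_numbers_PiM[OF f])
  then have "AE \<omega> in M. (\<lambda>n. (\<Sum>i<n. f (X (Suc i) \<omega>)) / n) \<longlonglongrightarrow> integral\<^sup>L L f"
    by (rule AE_distrD[rotated]) (rule measurable_PiM_single', use rv in \<open>auto dest: measurable_space\<close>)
  moreover have "(\<Sum>i<n. f (X (Suc i) \<omega>)) = (\<Sum>i=1..n. f (X i \<omega>))" for n \<omega>
    by (rule sum.reindex_bij_witness[where j = Suc and i = "\<lambda>i. i - 1"]) auto
  ultimately show ?thesis by simp
qed

section \<open>Convex minimization and means along a convergent sequence\<close>

text \<open>
  The almost sure Lipschitz bound can be used at countably many points at once only. Monotonicity
  carries it to the whole interval: away from \<open>c\<close>, the value at \<open>s\<close> is trapped between the value at \<open>c\<close>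
  and that at a point of \<open>D\<close> slightly beyond \<open>s\<close>. The end points have no points beyond them and must
  therefore belong to \<open>D\<close>.
\<close>

lemma antimono_lipschitz_at_extend:
  fixes \<phi> :: "real \<Rightarrow> real"
  assumes anti: "\<And>s t. a \<le> s \<Longrightarrow> s \<le> t \<Longrightarrow> t \<le> b \<Longrightarrow> \<phi> t \<le> \<phi> s"
    and dense: "\<And>s t. a \<le> s \<Longrightarrow> s < t \<Longrightarrow> t \<le> b \<Longrightarrow> \<exists>d\<in>D. s < d \<and> d < t"
    and D: "a \<in> D" "b \<in> D" "D \<subseteq> {a..b}"
    and c: "c \<in> {a..b}" and K: "K \<ge> 0"
    and lip: "\<And>d. d \<in> D \<Longrightarrow> \<bar>\<phi> d - \<phi> c\<bar> \<le> K * \<bar>d - c\<bar>"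
    and s: "s \<in> {a..b}"
  shows "\<bar>\<phi> s - \<phi> c\<bar> \<le> K * \<bar>s - c\<bar>"
proof (cases "s = a \<or> s = b \<or> s = c")
  case True
  then show ?thesis using lip D by auto
next
  case False
  have "\<bar>\<phi> s - \<phi> c\<bar> \<le> K * \<bar>s - c\<bar> + e" if "e > 0" for e
  proof -
    define \<eta> where "\<eta> = e / (K + 1)"
    have \<eta>: "\<eta> > 0" "K * \<eta> \<le> e"
      using K that by (auto simp: \<eta>_def field_simps)
    obtain d where d: "d \<in> D" "\<bar>d - c\<bar> \<le> \<bar>s - c\<bar> + \<eta>" "\<bar>\<phi> s - \<phi> c\<bar> \<le> \<bar>\<phi> d - \<phi> c\<bar>"
    proof (cases "s > c")
      case True
      obtain d where "d \<in> D" "s < d" "d < min b (s + \<eta>)"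
        using dense[of s "min b (s + \<eta>)"] False s \<eta> by auto
      moreover have "\<phi> d \<le> \<phi> s" "\<phi> s \<le> \<phi> c"
        using calculation True s c by (auto intro!: anti)
      ultimately show ?thesis using True by (intro that[of d]) auto
    next
      case less: False
      obtain d where "d \<in> D" "max a (s - \<eta>) < d" "d < s"
        using dense[of "max a (s - \<eta>)" s] False s \<eta> by auto
      moreover have "\<phi> s \<le> \<phi> d" "\<phi> c \<le> \<phi> s"
        using calculation less s c by (auto intro!: anti)
      ultimately show ?thesis using less by (intro that[of d]) auto
    qed
    have "\<bar>\<phi> s - \<phi> c\<bar> \<le> K * \<bar>d - c\<bar>" using d lip by force
    also have "\<dots> \<le> K * (\<bar>s - c\<bar> + \<eta>)" using d K by (intro mult_left_mono) auto
    also have "\<dots> \<le> K * \<bar>s - c\<bar> + e" using \<eta> by (simp add: distrib_left)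
    finally show ?thesis .
  qed
  then show ?thesis by (rule field_le_epsilon)
qed

lemma convex_on_segment_le_max:
  fixes g :: "real \<Rightarrow> real"
  assumes "convex_on {a..b} g" "x \<in> {a..b}" "y \<in> {a..b}" "d \<in> closed_segment x y"
  shows "g d \<le> max (g x) (g y)"
proof -
  obtain w where w: "0 \<le> w" "w \<le> 1" "d = (1 - w) * x + w * y"
    using assms(4) by (auto simp: in_segment)
  have "g d \<le> (1 - w) * g x + w * g y"
    using convex_onD[OF assms(1), of w x y] w assms by simp
  also have "\<dots> \<le> (1 - w) * max (g x) (g y) + w * max (g x) (g y)"
    using w by (intro add_mono mult_left_mono) auto
  finally show ?thesis by (simp add: algebra_simps)
qed

lemma convex_on_sum_functions:
  fixes f :: "'i \<Rightarrow> 'b::real_vector \<Rightarrow> real"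
  assumes "convex S" and "\<And>i. i \<in> I \<Longrightarrow> convex_on S (f i)"
  shows "convex_on S (\<lambda>x. \<Sum>i\<in>I. f i x)"
  using assms(2)
proof (induction I rule: infinite_finite_induct)
  case (insert i I)
  then have "convex_on S (\<lambda>x. f i x + (\<Sum>i\<in>I. f i x))"
    by (intro convex_on_add) auto
  with insert.hyps show ?case by simp
qed (simp_all add: convex_on_const assms(1))

text \<open>
  Fix \<open>d \<in> D\<close> close to \<open>c\<close>. Eventually \<open>g n d > g n c\<close>, and then no minimizer of the convex function \<open>g n\<close>
  lies at or beyond \<open>d\<close> as seen from \<open>c\<close>. So pointwise convergence on \<open>D\<close> does
  the work of the uniform convergence required for minimizers of general functions.
\<close>

lemma convex_minimizers_tendsto:
  fixes g :: "nat \<Rightarrow> real \<Rightarrow> real"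
  assumes conv: "\<And>n. convex_on {a..b} (g n)"
    and min: "\<forall>\<^sub>F n in sequentially. x n \<in> {a..b} \<and> (\<forall>s\<in>{a..b}. g n (x n) \<le> g n s)"
    and dense: "\<And>s t. a \<le> s \<Longrightarrow> s < t \<Longrightarrow> t \<le> b \<Longrightarrow> \<exists>d\<in>D. s < d \<and> d < t"
    and D: "D \<subseteq> {a..b}" "c \<in> D"
    and lim: "\<And>d. d \<in> D \<Longrightarrow> (\<lambda>n. g n d) \<longlonglongrightarrow> G d"
    and unique: "\<And>d. d \<in> D \<Longrightarrow> d \<noteq> c \<Longrightarrow> G c < G d"
  shows "x \<longlonglongrightarrow> c"
proof -
  have c: "c \<in> {a..b}" using D by auto
  have barrier: "\<forall>\<^sub>F n in sequentially. x n \<in> {a..b} \<and> d \<notin> closed_segment c (x n)"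
    if d: "d \<in> D" "d \<noteq> c" for d
  proof -
    have "(\<lambda>n. g n d - g n c) \<longlonglongrightarrow> G d - G c"
      using d D by (intro tendsto_diff lim)
    then have "\<forall>\<^sub>F n in sequentially. 0 < g n d - g n c"
      using unique[OF d] by (intro order_tendstoD) auto
    with min show ?thesis
    proof eventually_elim
      case (elim n)
      then show ?case
        using convex_on_segment_le_max[OF conv[of n] c, of "x n" d] c by force
    qed
  qed
  show ?thesis
  proof (rule order_tendstoI)
    fix y assume y: "y < c"
    show "\<forall>\<^sub>F n in sequentially. y < x n"
    proof (cases "y < a")
      case True
      then show ?thesis using min by (auto elim: eventually_mono)
    next
      case False
      then obtain d where d: "d \<in> D" "y < d" "d < c"
        using dense[of y c] y c by auto
      then have "\<forall>\<^sub>F n in sequentially. x n \<in> {a..b} \<and> d \<notin> closed_segment c (x n)"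
        by (intro barrier) auto
      then show ?thesis
        by eventually_elim (use d in \<open>auto simp: closed_segment_eq_real_ivl split: if_splits\<close>)
    qed
  next
    fix y assume y: "c < y"
    show "\<forall>\<^sub>F n in sequentially. x n < y"
    proof (cases "b < y")
      case True
      then show ?thesis using min by (auto elim: eventually_mono)
    next
      case False
      then obtain d where d: "d \<in> D" "c < d" "d < y"
        using dense[of c y] y c by auto
      then have "\<forall>\<^sub>F n in sequentially. x n \<in> {a..b} \<and> d \<notin> closed_segment c (x n)"
        by (intro barrier) auto
      then show ?thesis
        by eventually_elim (use d in \<open>auto simp: closed_segment_eq_real_ivl split: if_splits\<close>)
    qed
  qed
qed

lemma mean_diff_le:
  fixes p q r :: "nat \<Rightarrow> real"
  assumes "\<And>i. i \<in> {1..n} \<Longrightarrow> \<bar>p i - q i\<bar> \<le> e * r i"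
  shows "\<bar>(\<Sum>i=1..n. p i) / n - (\<Sum>i=1..n. q i) / n\<bar> \<le> e * ((\<Sum>i=1..n. r i) / n)"
proof -
  have "\<bar>(\<Sum>i=1..n. p i) - (\<Sum>i=1..n. q i)\<bar> \<le> (\<Sum>i=1..n. \<bar>p i - q i\<bar>)"
    unfolding sum_subtractf[symmetric] by (rule sum_abs)
  also have "\<dots> \<le> (\<Sum>i=1..n. e * r i)" by (rule sum_mono) (rule assms)
  also have "\<dots> = e * (\<Sum>i=1..n. r i)" by (simp add: sum_distrib_left)
  finally show ?thesis
    by (simp add: diff_divide_distrib[symmetric] divide_right_mono)
qed

text \<open>
  A Lipschitz bound for squares whose factor, a combination of \<open>k\<^sup>2\<close> and \<open>q\<^sup>2\<close>, has finite mean as soon as \<open>k\<close> and \<open>q\<close> have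
  finite second moments; it comes from \<open>2 * k * \<bar>q\<bar> \<le> k\<^sup>2 + q\<^sup>2\<close>.
\<close>

lemma abs_power2_diff_le:
  fixes p q k e :: real
  assumes "\<bar>p - q\<bar> \<le> k * e" "0 \<le> e"
  shows "\<bar>p\<^sup>2 - q\<^sup>2\<bar> \<le> e * ((1 + e) * k\<^sup>2 + q\<^sup>2)"
proof -
  have "\<bar>p\<^sup>2 - q\<^sup>2\<bar> = \<bar>p - q\<bar> * \<bar>p + q\<bar>"
    by (simp add: power2_eq_square abs_mult[symmetric] algebra_simps)
  also have "\<dots> \<le> (k * e) * (2 * \<bar>q\<bar> + k * e)"
    using assms by (intro mult_mono) auto
  also have "\<dots> = e * (2 * k * \<bar>q\<bar> + e * k\<^sup>2)"
    by (simp add: power2_eq_square algebra_simps)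
  also have "\<dots> \<le> e * ((k\<^sup>2 + q\<^sup>2) + e * k\<^sup>2)"
    using assms sum_squares_bound[of k "\<bar>q\<bar>"] by (intro mult_left_mono add_mono) auto
  finally show ?thesis by (simp add: algebra_simps)
qed

text \<open>
  Moving the argument from \<open>c\<close> to \<open>x n\<close> changes the \<open>n\<close>-th mean by at most \<open>\<bar>x n - c\<bar>\<close> times a mean of
  Lipschitz factors. The latter converges, hence is bounded, and the product tends to 0.
\<close>

lemma means_at_convergent_points_tendsto:
  fixes f :: "nat \<Rightarrow> real \<Rightarrow> real"
  assumes x: "x \<longlonglongrightarrow> c" and xT: "\<forall>\<^sub>F n in sequentially. x n \<in> T"
    and lip: "\<And>i s. i \<ge> 1 \<Longrightarrow> s \<in> T \<Longrightarrow> \<bar>f i s - f i c\<bar> \<le> k i * \<bar>s - c\<bar>"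
    and k1: "(\<lambda>n. (\<Sum>i=1..n. k i) / n) \<longlonglongrightarrow> \<kappa>1"
    and k2: "(\<lambda>n. (\<Sum>i=1..n. (k i)\<^sup>2) / n) \<longlonglongrightarrow> \<kappa>2"
    and f1: "(\<lambda>n. (\<Sum>i=1..n. f i c) / n) \<longlonglongrightarrow> m1"
    and f2: "(\<lambda>n. (\<Sum>i=1..n. (f i c)\<^sup>2) / n) \<longlonglongrightarrow> m2"
  shows "(\<lambda>n. (\<Sum>i=1..n. f i (x n)) / n) \<longlonglongrightarrow> m1"
    and "(\<lambda>n. (\<Sum>i=1..n. (f i (x n))\<^sup>2) / n) \<longlonglongrightarrow> m2"
proof -
  have e: "(\<lambda>n. \<bar>x n - c\<bar>) \<longlonglongrightarrow> 0"
    using x by (simp add: LIM_zero tendsto_rabs_zero)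
  have "(\<lambda>n. (\<Sum>i=1..n. f i (x n)) / n - (\<Sum>i=1..n. f i c) / n) \<longlonglongrightarrow> 0"
  proof (rule Lim_null_comparison)
    show "\<forall>\<^sub>F n in sequentially. norm ((\<Sum>i=1..n. f i (x n)) / n - (\<Sum>i=1..n. f i c) / n)
        \<le> \<bar>x n - c\<bar> * ((\<Sum>i=1..n. k i) / n)"
      using xT
    proof eventually_elim
      case (elim n)
      then show ?case
        unfolding real_norm_def using lip by (intro mean_diff_le) (auto simp: mult.commute)
    qed
    show "(\<lambda>n. \<bar>x n - c\<bar> * ((\<Sum>i=1..n. k i) / n)) \<longlonglongrightarrow> 0"
      using tendsto_mult[OF e k1] by simp
  qed
  from tendsto_add[OF this f1] show "(\<lambda>n. (\<Sum>i=1..n. f i (x n)) / n) \<longlonglongrightarrow> m1"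
    by simp
  have "(\<lambda>n. (\<Sum>i=1..n. (f i (x n))\<^sup>2) / n - (\<Sum>i=1..n. (f i c)\<^sup>2) / n) \<longlonglongrightarrow> 0"
  proof (rule Lim_null_comparison)
    show "\<forall>\<^sub>F n in sequentially.
        norm ((\<Sum>i=1..n. (f i (x n))\<^sup>2) / n - (\<Sum>i=1..n. (f i c)\<^sup>2) / n)
        \<le> \<bar>x n - c\<bar> * ((1 + \<bar>x n - c\<bar>) * ((\<Sum>i=1..n. (k i)\<^sup>2) / n) + (\<Sum>i=1..n. (f i c)\<^sup>2) / n)"
      using xT
    proof eventually_elim
      case (elim n)
      let ?e = "\<bar>x n - c\<bar>"
      have "\<bar>(\<Sum>i=1..n. (f i (x n))\<^sup>2) / n - (\<Sum>i=1..n. (f i c)\<^sup>2) / n\<bar>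
          \<le> ?e * ((\<Sum>i=1..n. (1 + ?e) * (k i)\<^sup>2 + (f i c)\<^sup>2) / n)"
        using lip elim by (intro mean_diff_le abs_power2_diff_le) auto
      then show ?case
        by (simp add: sum.distrib sum_distrib_left[symmetric] add_divide_distrib)
    qed
    show "(\<lambda>n. \<bar>x n - c\<bar> * ((1 + \<bar>x n - c\<bar>) * ((\<Sum>i=1..n. (k i)\<^sup>2) / n)
        + (\<Sum>i=1..n. (f i c)\<^sup>2) / n)) \<longlonglongrightarrow> 0"
      using tendsto_mult[OF e tendsto_add[OF tendsto_mult[OF tendsto_add[OF tendsto_const e] k2] f2]]
      by simp
  qed
  from tendsto_add[OF this f2] show "(\<lambda>n. (\<Sum>i=1..n. (f i (x n))\<^sup>2) / n) \<longlonglongrightarrow> m2"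
    by simp
qed

section \<open>Losses and extended-valued expectations\<close>

lemma loss_of_not_MInfty:
  assumes "utility_function u"
  shows "loss_of u z \<noteq> -\<infinity>"
  using assms by (auto simp: utility_function_def proper_concave_def loss_of_def)

lemma mono_loss_of:
  assumes "utility_function u"
  shows "mono (loss_of u)"
  using assms by (auto simp: utility_function_def loss_of_def mono_def)

lemma loss_of_convex:
  assumes u: "utility_function u" and p: "loss_of u x = ereal p" and q: "loss_of u y = ereal q"
    and w: "0 \<le> w" "w \<le> 1"
  shows "loss_of u ((1 - w) * x + w * y) \<le> ereal ((1 - w) * p + w * q)"
proof -
  have "(- x, - p) \<in> hypograph u" "(- y, - q) \<in> hypograph u"
    using p q by (auto simp: loss_of_def hypograph_def ereal_uminus_eq_reorder)
  moreover have "convex (hypograph u)"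
    using u by (simp add: utility_function_def proper_concave_def)
  ultimately have "(1 - w) *\<^sub>R (- x, - p) + w *\<^sub>R (- y, - q) \<in> hypograph u"
    using w by (intro convexD) auto
  then have "ereal (- ((1 - w) * p + w * q)) \<le> u (- ((1 - w) * x + w * y))"
    by (simp add: hypograph_def algebra_simps)
  then show ?thesis
    unfolding loss_of_def by (metis ereal_uminus_le_reorder uminus_ereal.simps(1))
qed

text \<open>
  The sublevel sets of the loss are sections of the reflected hypograph of \<open>u\<close>, which is closed.
\<close>

lemma borel_measurable_loss_of:
  assumes u: "utility_function u"
  shows "loss_of u \<in> borel_measurable borel"
proof (rule borel_measurableI_le)
  fix y :: ereal
  show "{x \<in> space borel. loss_of u x \<le> y} \<in> sets borel"
  proof (cases y)
    case (real r)
    have "{x. loss_of u x \<le> ereal r} = (\<lambda>x. (- x, - r)) -` hypograph u"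
      by (auto simp: loss_of_def hypograph_def ereal_uminus_le_reorder)
    moreover have "closed ((\<lambda>x. (- x, - r)) -` hypograph u)"
      using u by (intro closed_vimage continuous_intros)
        (simp add: utility_function_def closed_concave_def)
    ultimately show ?thesis using real by simp
  qed (use loss_of_not_MInfty[OF u] in auto)
qed

lemma sample_mean_ereal:
  assumes "\<And>i. i \<in> {1..n} \<Longrightarrow> f i = ereal (g i)"
  shows "sample_mean n f = ereal ((\<Sum>i=1..n. g i) / n)"
proof -
  have "(\<Sum>i=1..n. f i) = (\<Sum>i=1..n. ereal (g i))"
    using assms by (intro sum.cong) auto
  then show ?thesis by (simp add: sample_mean_def)
qed

lemma ext_expectation_nonneg:
  assumes "\<And>\<omega>. 0 \<le> X \<omega>"
  shows "ext_expectation M X = enn2ereal (\<integral>\<^sup>+\<omega>. e2ennreal (X \<omega>) \<partial>M)"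
  using assms by (simp add: ext_expectation_def e2ennreal_neg zero_ennreal.rep_eq)

text \<open>
  Brings an extended-valued variable back to the reals: a finite second moment excludes infinite values
  up to a null set.
\<close>

lemma finite_second_moment:
  assumes [measurable]: "X \<in> borel_measurable M"
    and fin: "ext_expectation M (\<lambda>\<omega>. (X \<omega>)\<^sup>2) < \<infinity>"
  shows "AE \<omega> in M. \<bar>X \<omega>\<bar> \<noteq> \<infinity>"
    and "integrable M (\<lambda>\<omega>. (real_of_ereal (X \<omega>))\<^sup>2)"
proof -
  have "0 \<le> (X \<omega>)\<^sup>2" for \<omega>
    by (cases "X \<omega>") auto
  then have "enn2ereal (\<integral>\<^sup>+\<omega>. e2ennreal ((X \<omega>)\<^sup>2) \<partial>M) < \<infinity>"
    using fin ext_expectation_nonneg[of "\<lambda>\<omega>. (X \<omega>)\<^sup>2" M] by simp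
  then have *: "(\<integral>\<^sup>+\<omega>. e2ennreal ((X \<omega>)\<^sup>2) \<partial>M) \<noteq> \<infinity>"
    by auto
  have "AE \<omega> in M. e2ennreal ((X \<omega>)\<^sup>2) \<noteq> \<infinity>"
  proof (rule nn_integral_PInf_AE)
    show "(\<lambda>\<omega>. e2ennreal ((X \<omega>)\<^sup>2)) \<in> borel_measurable M"
      unfolding power2_eq_square by measurable
  qed fact
  then show fin: "AE \<omega> in M. \<bar>X \<omega>\<bar> \<noteq> \<infinity>"
  proof eventually_elim
    case (elim \<omega>)
    then show ?case by (cases "X \<omega>") (auto simp: power2_eq_square)
  qed
  have "(\<integral>\<^sup>+\<omega>. ennreal ((real_of_ereal (X \<omega>))\<^sup>2) \<partial>M) = (\<integral>\<^sup>+\<omega>. e2ennreal ((X \<omega>)\<^sup>2) \<partial>M)"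
    using fin by (intro nn_integral_cong_AE) (auto elim!: eventually_mono)
  with * show "integrable M (\<lambda>\<omega>. (real_of_ereal (X \<omega>))\<^sup>2)"
    by (intro integrableI_nonneg) (auto simp: less_top)
qed

section \<open>Consistency of the sample variance\<close>

theorem proposition3:
  fixes M :: "'a measure"
    and u l :: "real \<Rightarrow> ereal"
    and \<xi> :: "'a \<Rightarrow> real" and \<xi>s :: "nat \<Rightarrow> 'a \<Rightarrow> real"
    and T :: "real set" and tstar :: real
    and t :: "nat \<Rightarrow> 'a \<Rightarrow> real"
    and K :: "real \<Rightarrow> real"
  assumes "prob_space M"
    and "utility_function u" and "l = loss_of u"
    and "\<xi> \<in> borel_measurable M"
    and "compact T" and "is_interval T"
    and indep: "prob_space.indep_vars M (\<lambda>_. borel) \<xi>s {1..}"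
    and copies: "\<And>i. i \<ge> 1 \<Longrightarrow> distr M borel (\<xi>s i) = distr M borel \<xi>"
    and t_n: "\<And>n. n \<ge> 1 \<Longrightarrow>
      AE \<omega> in M. t n \<omega> \<in> optimal_solutions (saa_objective l n (\<lambda>i. \<xi>s i \<omega>)) T"
    and S: "optimal_solutions (true_objective M l \<xi>) T = {tstar}"
    and second_moment: "(SUP s\<in>T. ext_expectation M (\<lambda>\<omega>. (l (\<xi> \<omega> - s))\<^sup>2)) < \<infinity>"
    and "K \<in> borel_measurable borel" and "integrable M (\<lambda>\<omega>. (K (\<xi> \<omega>))\<^sup>2)"
    and lipschitz: "\<And>t1 t2. t1 \<in> T \<Longrightarrow> t2 \<in> T \<Longrightarrow>
      AE \<omega> in M. \<bar>l (\<xi> \<omega> - t1) - l (\<xi> \<omega> - t2)\<bar> \<le> ereal (K (\<xi> \<omega>) * \<bar>t1 - t2\<bar>)"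
  shows "AE \<omega> in M.
    (\<lambda>n. saa_variance l n (\<lambda>i. \<xi>s i \<omega>) (t n \<omega>))
      \<longlonglongrightarrow> ext_variance M (\<lambda>\<omega>. l (\<xi> \<omega> - tstar))"
proof -
  interpret prob_space M by fact
  have u: "utility_function u" and l: "l = loss_of u" by fact+
  have [measurable]: "\<xi> \<in> borel_measurable M" "K \<in> borel_measurable borel" by fact+
  have l_meas [measurable]: "l \<in> borel_measurable borel"
    unfolding l by (rule borel_measurable_loss_of[OF u])
  have mono_l: "l x \<le> l y" if "x \<le> y" for x y
    using mono_loss_of[OF u] that by (auto simp: l mono_def)
  have tstar_T: "tstar \<in> T"
    using S by (auto simp: optimal_solutions_def is_arg_min_def)
  obtain a b where T: "T = {a..b}"
    using is_interval_compact[of T] \<open>compact T\<close> \<open>is_interval T\<close> by auto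
  have ab: "a \<le> tstar" "tstar \<le> b" using tstar_T T by auto

  define h where "h x = real_of_ereal (l x)" for x
  have [measurable]: "h \<in> borel_measurable borel"
    unfolding h_def by measurable
  \<comment> \<open>The loss is monotone and never \<open>-\<infinity>\<close>, so finiteness at the left end point \<open>a\<close> of \<open>T\<close> gives finiteness
    on all of \<open>T\<close>. This replaces uncountably many almost sure statements by one.\<close>
  have l_h: "l (x - s) = ereal (h (x - s))" if "l (x - a) \<noteq> \<infinity>" "a \<le> s" for x s
  proof -
    have "l (x - s) \<le> l (x - a)" using that by (intro mono_l) auto
    then have "\<bar>l (x - s)\<bar> \<noteq> \<infinity>"
      using that loss_of_not_MInfty[OF u, of "x - s"] by (auto simp: l)
    then show ?thesis by (simp add: h_def ereal_real')
  qed
  have h_antimono: "h (x - t') \<le> h (x - s)" if "l (x - a) \<noteq> \<infinity>" "a \<le> s" "s \<le> t'" for x s t'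
    using mono_l[of "x - t'" "x - s"] l_h[OF that(1), of s] l_h[OF that(1), of t'] that by simp
  have h_convex: "convex_on {a..b} (\<lambda>s. h (x - s))" if "l (x - a) \<noteq> \<infinity>" for x
  proof (rule convex_onI)
    fix w s r :: real assume w: "0 < w" "w < 1" and sr: "s \<in> {a..b}" "r \<in> {a..b}"
    have "a \<le> (1 - w) * s + w * r"
      using convexD[OF convex_real_interval(5)[of a b] sr, of "1 - w" w] w by auto
    moreover have "x - ((1 - w) * s + w * r) = (1 - w) * (x - s) + w * (x - r)"
      by (simp add: algebra_simps)
    then have "l (x - ((1 - w) * s + w * r)) \<le> ereal ((1 - w) * h (x - s) + w * h (x - r))"
      unfolding l using l_h[OF that, unfolded l] sr w
      by (simp only:) (intro loss_of_convex[OF u], auto)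
    ultimately show "h (x - ((1 - w) *\<^sub>R s + w *\<^sub>R r)) \<le> (1 - w) * h (x - s) + w * h (x - r)"
      using l_h[OF that, of "(1 - w) * s + w * r"] by simp
  qed simp

  have moment: "ext_expectation M (\<lambda>\<omega>. (l (\<xi> \<omega> - s))\<^sup>2) < \<infinity>" if "s \<in> T" for s
    using second_moment that by (meson SUP_upper le_less_trans)
  have fin: "AE \<omega> in M. l (\<xi> \<omega> - a) \<noteq> \<infinity>"
  proof -
    have "AE \<omega> in M. \<bar>l (\<xi> \<omega> - a)\<bar> \<noteq> \<infinity>"
      using moment[of a] T ab by (intro finite_second_moment) auto
    then show ?thesis by (auto elim: eventually_mono)
  qed
  have int2: "integrable M (\<lambda>\<omega>. (h (\<xi> \<omega> - s))\<^sup>2)" if "s \<in> T" for s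
    unfolding h_def using moment[OF that] by (intro finite_second_moment) auto
  have int1: "integrable M (\<lambda>\<omega>. h (\<xi> \<omega> - s))" if "s \<in> T" for s
    by (rule square_integrable_imp_integrable[OF _ int2[OF that]]) measurable
  have l_h_AE: "AE \<omega> in M. l (\<xi> \<omega> - s) = ereal (h (\<xi> \<omega> - s))" if "s \<in> T" for s
    using fin that T by (auto elim!: eventually_mono intro: l_h)

  define G where "G s = s + expectation (\<lambda>\<omega>. h (\<xi> \<omega> - s))" for s
  have obj: "true_objective M l \<xi> s = ereal (G s)" if "s \<in> T" for s
    using ext_expectation_eq_expectation[OF int1[OF that] l_h_AE[OF that]]
    by (simp add: true_objective_def G_def)
  have unique: "G tstar < G s" if s: "s \<in> T" "s \<noteq> tstar" for s
  proof -
    have "tstar \<in> optimal_solutions (true_objective M l \<xi>) T" using S by simp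
    then have min: "G tstar \<le> G r" if "r \<in> T" for r
      using obj[OF that] obj[OF tstar_T] that
      by (auto simp: optimal_solutions_def is_arg_min_def not_less)
    have "s \<notin> optimal_solutions (true_objective M l \<xi>) T" using S s by simp
    then obtain r where "r \<in> T" "G r < G s"
      using s obj by (auto simp: optimal_solutions_def is_arg_min_def)
    with min[of r] show ?thesis by simp
  qed

  \<comment> \<open>Almost sure statements are collected over this countable set. It contains the end points for the
    extension of the Lipschitz bound and \<open>tstar\<close> as the reference point.\<close>
  define D where "D = {a, b, tstar} \<union> (\<rat> \<inter> {a..b})"
  have D_T: "D \<subseteq> {a..b}" using ab by (auto simp: D_def)
  have D_countable: "countable D"
    unfolding D_def by (intro countable_Un countable_Int1 countable_rat) auto
  have D_dense: "\<exists>d\<in>D. s < d \<and> d < r" if sr: "a \<le> s" "s < r" "r \<le> b" for s r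
  proof -
    obtain q where "q \<in> \<rat>" "s < q" "q < r" using Rats_dense_in_real[OF sr(2)] by blast
    then show ?thesis using sr by (auto simp: D_def intro!: bexI[of _ q])
  qed

  have rv [measurable]: "\<xi>s i \<in> borel_measurable M" if "i \<ge> 1" for i
    using indep that by (auto simp: indep_vars_def2)
  \<comment> \<open>Almost sure properties of the loss variable pass to all of its copies, as they depend on the law only.\<close>
  have AE_copies: "AE \<omega> in M. \<forall>i\<ge>1. P (\<xi>s i \<omega>)"
    if "AE \<omega> in M. P (\<xi> \<omega>)" and [measurable]: "Measurable.pred borel P" for P
  proof -
    have "AE \<omega> in M. i \<ge> 1 \<longrightarrow> P (\<xi>s i \<omega>)" for i
    proof (cases "i \<ge> 1")
      case True
      have "AE x in distr M borel \<xi>. P x"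
        using that(1) by (subst AE_distr_iff) auto
      then have "AE x in distr M borel (\<xi>s i). P x"
        unfolding copies[OF True] .
      then have "AE \<omega> in M. P (\<xi>s i \<omega>)"
        by (rule AE_distrD[OF rv[OF True]])
      then show ?thesis by simp
    qed simp
    then show ?thesis by (simp add: AE_all_countable)
  qed
  have SLLN: "AE \<omega> in M. (\<lambda>n. (\<Sum>i=1..n. f (\<xi>s i \<omega>)) / n) \<longlonglongrightarrow> expectation (\<lambda>\<omega>. f (\<xi> \<omega>))"
    if [measurable]: "f \<in> borel_measurable borel" and "integrable M (\<lambda>\<omega>. f (\<xi> \<omega>))" for f
    using strong_law_of_large_numbers[OF indep copies, of f] that
    by (simp add: integrable_distr_eq integral_distr)

  have K2: "integrable M (\<lambda>\<omega>. (K (\<xi> \<omega>))\<^sup>2)" by fact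
  have K1: "integrable M (\<lambda>\<omega>. K (\<xi> \<omega>))"
    by (rule square_integrable_imp_integrable[OF _ K2]) measurable

  \<comment> \<open>From here on: countably many almost sure events, on whose intersection the rest is deterministic.\<close>
  have "AE \<omega> in M. \<forall>i\<ge>1. l (\<xi>s i \<omega> - a) \<noteq> \<infinity>"
    by (rule AE_copies[OF fin]) measurable
  \<comment> \<open>The absolute value of \<open>K\<close> provides a nonnegative Lipschitz factor; if \<open>T\<close> is a single point, \<open>K\<close> itself
    may be negative.\<close>
  moreover have "AE \<omega> in M. \<forall>d\<in>D. \<forall>i\<ge>1. \<bar>h (\<xi>s i \<omega> - d) - h (\<xi>s i \<omega> - tstar)\<bar> \<le> \<bar>K (\<xi>s i \<omega>)\<bar> * \<bar>d - tstar\<bar>"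
  proof (subst AE_ball_countable[OF D_countable], intro ballI AE_copies)
    fix d assume d: "d \<in> D"
    then have dT: "d \<in> T" using D_T T by auto
    show "AE \<omega> in M. \<bar>h (\<xi> \<omega> - d) - h (\<xi> \<omega> - tstar)\<bar> \<le> \<bar>K (\<xi> \<omega>)\<bar> * \<bar>d - tstar\<bar>"
      using lipschitz[OF dT tstar_T] l_h_AE[OF dT] l_h_AE[OF tstar_T]
    proof eventually_elim
      case (elim \<omega>)
      then have "\<bar>h (\<xi> \<omega> - d) - h (\<xi> \<omega> - tstar)\<bar> \<le> K (\<xi> \<omega>) * \<bar>d - tstar\<bar>"
        by simp
      also have "\<dots> \<le> \<bar>K (\<xi> \<omega>)\<bar> * \<bar>d - tstar\<bar>"
        by (intro mult_right_mono) auto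
      finally show ?case .
    qed
  qed measurable
  moreover have "AE \<omega> in M. \<forall>n\<ge>1. t n \<omega> \<in> optimal_solutions (saa_objective l n (\<lambda>i. \<xi>s i \<omega>)) T"
    using t_n by (simp add: AE_all_countable)
  moreover have "AE \<omega> in M. \<forall>d\<in>D. (\<lambda>n. (\<Sum>i=1..n. h (\<xi>s i \<omega> - d)) / n) \<longlonglongrightarrow> expectation (\<lambda>\<omega>. h (\<xi> \<omega> - d))"
    using D_T T by (subst AE_ball_countable[OF D_countable]) (intro ballI SLLN int1, auto)
  moreover have "AE \<omega> in M. (\<lambda>n. (\<Sum>i=1..n. (h (\<xi>s i \<omega> - tstar))\<^sup>2) / n) \<longlonglongrightarrow> expectation (\<lambda>\<omega>. (h (\<xi> \<omega> - tstar))\<^sup>2)"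
    by (rule SLLN[OF _ int2[OF tstar_T]]) measurable
  moreover have "AE \<omega> in M. (\<lambda>n. (\<Sum>i=1..n. \<bar>K (\<xi>s i \<omega>)\<bar>) / n) \<longlonglongrightarrow> expectation (\<lambda>\<omega>. \<bar>K (\<xi> \<omega>)\<bar>)"
    by (rule SLLN[OF _ integrable_abs[OF K1]]) measurable
  moreover have "AE \<omega> in M. (\<lambda>n. (\<Sum>i=1..n. \<bar>K (\<xi>s i \<omega>)\<bar>\<^sup>2) / n) \<longlonglongrightarrow> expectation (\<lambda>\<omega>. (K (\<xi> \<omega>))\<^sup>2)"
    unfolding power2_abs by (rule SLLN[OF _ K2]) measurable
  ultimately show ?thesis
  proof eventually_elim
    case (elim \<omega>)
    define x where "x i = \<xi>s i \<omega>" for i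
    have x_fin: "l (x i - a) \<noteq> \<infinity>" if "i \<ge> 1" for i
      using elim(1) that by (simp add: x_def)
    define g where "g n s = s + (\<Sum>i=1..n. h (x i - s)) / n" for n s
    have g_eq: "saa_objective l n x s = ereal (g n s)" if "s \<in> T" for n s
    proof -
      have "sample_mean n (\<lambda>i. l (x i - s)) = ereal ((\<Sum>i=1..n. h (x i - s)) / n)"
        using that T x_fin by (intro sample_mean_ereal l_h) auto
      then show ?thesis by (simp add: saa_objective_def g_def)
    qed
    have g_min: "t n \<omega> \<in> T \<and> (\<forall>s\<in>T. g n (t n \<omega>) \<le> g n s)" if "n \<ge> 1" for n
    proof -
      have "is_arg_min (saa_objective l n x) (\<lambda>s. s \<in> T) (t n \<omega>)"
        using elim(3) that by (simp add: optimal_solutions_def x_def[abs_def])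
      then show ?thesis
        using g_eq by (auto simp: is_arg_min_def not_less)
    qed
    have g_convex: "convex_on {a..b} (g n)" for n
    proof -
      have "convex_on {a..b} (\<lambda>s. \<Sum>i=1..n. h (x i - s))"
        using x_fin by (intro convex_on_sum_functions h_convex) auto
      then have "convex_on {a..b} (\<lambda>s. s + (1 / n) * (\<Sum>i=1..n. h (x i - s)))"
        by (intro convex_on_add convex_on_cmul) (auto simp: convex_on_ident)
      then show ?thesis by (simp add: g_def[abs_def])
    qed
    have t_lim: "(\<lambda>n. t n \<omega>) \<longlonglongrightarrow> tstar"
    proof (rule convex_minimizers_tendsto[where g = g and G = G and D = D])
      show "\<forall>\<^sub>F n in sequentially. t n \<omega> \<in> {a..b} \<and> (\<forall>s\<in>{a..b}. g n (t n \<omega>) \<le> g n s)"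
        using g_min T by (intro eventually_sequentiallyI[of 1]) auto
      show "(\<lambda>n. g n d) \<longlonglongrightarrow> G d" if "d \<in> D" for d
        unfolding g_def G_def x_def using elim(4) that by (intro tendsto_add tendsto_const) auto
      show "tstar \<in> D" by (simp add: D_def)
      show "G tstar < G d" if "d \<in> D" "d \<noteq> tstar" for d
        using that unique D_T T by auto
    qed (use g_convex D_dense D_T in auto)
    have lip: "\<bar>h (x i - s) - h (x i - tstar)\<bar> \<le> \<bar>K (x i)\<bar> * \<bar>s - tstar\<bar>" if "i \<ge> 1" "s \<in> T" for i s
    proof (rule antimono_lipschitz_at_extend[where a = a and b = b and D = D and \<phi> = "\<lambda>s. h (x i - s)"])
      show "h (x i - r) \<le> h (x i - q)" if "a \<le> q" "q \<le> r" "r \<le> b" for q r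
        using that x_fin[OF \<open>i \<ge> 1\<close>] by (intro h_antimono) auto
      show "\<bar>h (x i - d) - h (x i - tstar)\<bar> \<le> \<bar>K (x i)\<bar> * \<bar>d - tstar\<bar>" if "d \<in> D" for d
        using elim(2) that \<open>i \<ge> 1\<close> by (simp add: x_def)
    qed (use D_dense D_T T ab that in \<open>auto simp: D_def\<close>)
    have tT: "\<forall>\<^sub>F n in sequentially. t n \<omega> \<in> T"
      using g_min by (intro eventually_sequentiallyI[of 1]) auto
    define m where "m p n = (\<Sum>i=1..n. h (x i - t n \<omega>) ^ p) / n" for p n
    have limits:
      "(\<lambda>n. (\<Sum>i=1..n. \<bar>K (x i)\<bar>) / n) \<longlonglongrightarrow> expectation (\<lambda>\<omega>. \<bar>K (\<xi> \<omega>)\<bar>)"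
      "(\<lambda>n. (\<Sum>i=1..n. \<bar>K (x i)\<bar>\<^sup>2) / n) \<longlonglongrightarrow> expectation (\<lambda>\<omega>. (K (\<xi> \<omega>))\<^sup>2)"
      "(\<lambda>n. (\<Sum>i=1..n. h (x i - tstar)) / n) \<longlonglongrightarrow> expectation (\<lambda>\<omega>. h (\<xi> \<omega> - tstar))"
      "(\<lambda>n. (\<Sum>i=1..n. (h (x i - tstar))\<^sup>2) / n) \<longlonglongrightarrow> expectation (\<lambda>\<omega>. (h (\<xi> \<omega> - tstar))\<^sup>2)"
      using elim(6,7) bspec[OF elim(4), of tstar] elim(5) unfolding x_def by (simp_all add: D_def)
    note means = means_at_convergent_points_tendsto[where f = "\<lambda>i s. h (x i - s)",
        OF t_lim tT lip limits]
    have m1: "m 1 \<longlonglongrightarrow> expectation (\<lambda>\<omega>. h (\<xi> \<omega> - tstar))"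
      using means(1) by (simp add: m_def[abs_def])
    have m2: "m 2 \<longlonglongrightarrow> expectation (\<lambda>\<omega>. (h (\<xi> \<omega> - tstar))\<^sup>2)"
      using means(2) by (simp add: m_def[abs_def])
    have var_eq: "saa_variance l n x (t n \<omega>) = ereal (m 2 n - (m 1 n)\<^sup>2)" if "n \<ge> 1" for n
    proof -
      have l_x: "l (x i - t n \<omega>) = ereal (h (x i - t n \<omega>))" if "i \<in> {1..n}" for i
        using g_min[OF \<open>n \<ge> 1\<close>] T x_fin that by (intro l_h) auto
      have "sample_mean n (\<lambda>i. l (x i - t n \<omega>)) = ereal (m 1 n)"
        unfolding m_def by (rule sample_mean_ereal) (simp add: l_x)
      moreover have "sample_mean n (\<lambda>i. (l (x i - t n \<omega>))\<^sup>2) = ereal (m 2 n)"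
        unfolding m_def by (rule sample_mean_ereal) (simp add: l_x)
      ultimately show ?thesis by (simp add: saa_variance_def)
    qed
    have "(\<lambda>n. m 2 n - (m 1 n)\<^sup>2) \<longlonglongrightarrow> variance (\<lambda>\<omega>. h (\<xi> \<omega> - tstar))"
      unfolding variance_eq[OF int1[OF tstar_T] int2[OF tstar_T]]
      by (intro tendsto_diff tendsto_power m1 m2)
    then have "(\<lambda>n. ereal (m 2 n - (m 1 n)\<^sup>2)) \<longlonglongrightarrow> ext_variance M (\<lambda>\<omega>. l (\<xi> \<omega> - tstar))"
      using ext_variance_eq_variance[OF _ int2[OF tstar_T] l_h_AE[OF tstar_T]] by simp
    then have "(\<lambda>n. saa_variance l n x (t n \<omega>)) \<longlonglongrightarrow> ext_variance M (\<lambda>\<omega>. l (\<xi> \<omega> - tstar))"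
      by (rule Lim_transform_eventually) (auto simp: var_eq intro!: eventually_sequentiallyI[of 1])
    then show ?case by (simp add: x_def[abs_def])
  qed
qed

end
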